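(* Let $0<\theta\leq 1$, $0\leq\nu\leq1$, let $f,g\in L^{1,\nu}_{M}(\mathbb{R})$ and let $\phi,\psi$ be two compactly supported fractional wavelets. Then for every $a\in\mathbb{R}\setminus\{0\}$, $$\|(L_\phi^\theta f)(\cdot,a)-(L_\psi^\theta g)(\cdot,a)\|_{L^{1,\nu}_{M}(\mathbb{R})}\leq |a|^{\frac{1}{2\theta}}\left(\|f\|_{L^{1,\nu}_{M}(\mathbb{R})}\left\|\frac{\phi}{\sqrt{C_{\phi,\theta}}}-\frac{\psi}{\sqrt{C_{\psi,\theta}}}\right\|_{L^1(\mathbb{R})}+\|f-g\|_{L^{1,\nu}_{M}(\mathbb{R})}\left\|\frac{\psi}{\sqrt{C_{\psi,\theta}}}\right\|_{L^1(\mathbb{R})}\right).$$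
   Context: Functions are complex-valued on $\mathbb{R}$. For $0<\theta\leq1$, the fractional Fourier transform is $(\mathfrak{F}_\theta f)(\xi)=\int_{\mathbb{R}}e^{-i(\operatorname{sgn}\xi)|\xi|^{1/\theta}t}f(t)\,dt$. A fractional wavelet (of order $\theta$) is a non-zero function $\psi\in L^1(\mathbb{R})\cap L^2(\mathbb{R})$ with $C_{\psi,\theta}:=\int_{\mathbb{R}}\frac{|(\mathfrak{F}_\theta\psi)(\xi)|^2}{|\xi|}\,d\xi<\infty$. For $a\in\mathbb{R}\setminus\{0\}$, $b\in\mathbb{R}$, put $\psi_{a,b,\theta}(t)=\frac{1}{|a|^{1/(2\theta)}}\psi\left(\frac{t-b}{(\operatorname{sgn} a)|a|^{1/\theta}}\right)$. The continuous fractional wavelet transform (CFrWT) of $f$ is $(W_\psi^\theta f)(b,a)=\int_{\mathbb{R}}f(t)\overline{\psi_{a,b,\theta}(t)}\,dt$ whenever the integral is well-defined, and its normalized form is $L_\psi^\theta:=\frac{1}{\sqrt{C_{\psi,\theta}}}W_\psi^\theta$. For fixed $a$, $(L_\psi^\theta f)(\cdot,a)$ is regarded as a function of $b$ (defined almost everywhere). Morrey space: for $0\leq\nu\leq1$, $L^{1,\nu}_M(\mathbb{R})$ is the set of $f\in L^1_{loc}(\mathbb{R})$ with $\|f\|_{L^{1,\nu}_M(\mathbb{R})}:=\sup_{x\in\mathbb{R},\,r>0}\frac{1}{r^\nu}\int_{B(x,r)}|f(t)|\,dt<\infty$, where $B(x,r)$ is the ball (interval) of centre $x$ and radius $r$.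 *)

theory Defs
  imports "HOL-Analysis.Analysis"
begin

text \<open>
  Functions are Lebesgue measurable representatives \<open>real \<Rightarrow> complex\<close>; notions that concern elements
  of \<open>L\<^sup>1\<close> or \<open>L\<^sup>2\<close> (being non-zero, being compactly supported) are understood up to null sets.
\<close>

definition frft :: "real \<Rightarrow> (real \<Rightarrow> complex) \<Rightarrow> real \<Rightarrow> complex" where
  "frft \<theta> f \<xi> =
     (LINT t|lebesgue. exp (- \<i> * complex_of_real (sgn \<xi> * \<bar>\<xi>\<bar> powr (1 / \<theta>) * t)) * f t)"

text \<open>The value of the integrand at \<open>\<xi> = 0\<close> (which is \<open>0\<close> by the convention on division) is immaterial.\<close>

definition adm_integral :: "real \<Rightarrow> (real \<Rightarrow> complex) \<Rightarrow> ennreal" where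
  "adm_integral \<theta> \<psi> = (\<integral>\<^sup>+ \<xi>. ennreal ((cmod (frft \<theta> \<psi> \<xi>))\<^sup>2 / \<bar>\<xi>\<bar>) \<partial>lebesgue)"

definition adm_const :: "real \<Rightarrow> (real \<Rightarrow> complex) \<Rightarrow> real" where
  "adm_const \<theta> \<psi> = enn2real (adm_integral \<theta> \<psi>)"

definition fractional_wavelet :: "real \<Rightarrow> (real \<Rightarrow> complex) \<Rightarrow> bool" where
  "fractional_wavelet \<theta> \<psi> \<longleftrightarrow>
     integrable lebesgue \<psi> \<and>
     integrable lebesgue (\<lambda>t. (cmod (\<psi> t))\<^sup>2) \<and>
     \<not> (AE t in lebesgue. \<psi> t = 0) \<and>
     adm_integral \<theta> \<psi> < \<infinity>"

definition compactly_supported :: "(real \<Rightarrow> complex) \<Rightarrow> bool" where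
  "compactly_supported \<psi> \<longleftrightarrow> (\<exists>K. compact K \<and> (AE t in lebesgue. t \<notin> K \<longrightarrow> \<psi> t = 0))"

definition daughter :: "real \<Rightarrow> (real \<Rightarrow> complex) \<Rightarrow> real \<Rightarrow> real \<Rightarrow> real \<Rightarrow> complex" where
  "daughter \<theta> \<psi> a b t =
     complex_of_real (1 / \<bar>a\<bar> powr (1 / (2 * \<theta>))) * \<psi> ((t - b) / (sgn a * \<bar>a\<bar> powr (1 / \<theta>)))"

text \<open>
  The Bochner integral is \<open>0\<close> when the integrand is not integrable, so the transform is meaningful
  at \<open>(b, a)\<close> only if \<open>cfrwt_defined\<close> holds there.
\<close>

definition cfrwt_defined :: "real \<Rightarrow> (real \<Rightarrow> complex) \<Rightarrow> (real \<Rightarrow> complex) \<Rightarrow> real \<Rightarrow> real \<Rightarrow> bool" where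
  "cfrwt_defined \<theta> \<psi> f b a \<longleftrightarrow> integrable lebesgue (\<lambda>t. f t * cnj (daughter \<theta> \<psi> a b t))"

definition cfrwt :: "real \<Rightarrow> (real \<Rightarrow> complex) \<Rightarrow> (real \<Rightarrow> complex) \<Rightarrow> real \<Rightarrow> real \<Rightarrow> complex" where
  "cfrwt \<theta> \<psi> f b a = (LINT t|lebesgue. f t * cnj (daughter \<theta> \<psi> a b t))"

definition normalized_cfrwt ::
  "real \<Rightarrow> (real \<Rightarrow> complex) \<Rightarrow> (real \<Rightarrow> complex) \<Rightarrow> real \<Rightarrow> real \<Rightarrow> complex" where
  "normalized_cfrwt \<theta> \<psi> f b a = complex_of_real (1 / sqrt (adm_const \<theta> \<psi>)) * cfrwt \<theta> \<psi> f b a"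

definition L1_norm :: "(real \<Rightarrow> complex) \<Rightarrow> ennreal" where
  "L1_norm f = (\<integral>\<^sup>+ t. ennreal (cmod (f t)) \<partial>lebesgue)"

definition L1_loc :: "(real \<Rightarrow> complex) set" where
  "L1_loc = {f. \<forall>K. compact K \<longrightarrow> f absolutely_integrable_on K}"

definition morrey_norm :: "real \<Rightarrow> (real \<Rightarrow> complex) \<Rightarrow> ennreal" where
  "morrey_norm \<nu> f =
     (SUP x. SUP r\<in>{0<..}. ennreal (1 / r powr \<nu>) * (\<integral>\<^sup>+ t\<in>ball x r. ennreal (cmod (f t)) \<partial>lebesgue))"

definition morrey_space :: "real \<Rightarrow> (real \<Rightarrow> complex) set" where
  "morrey_space \<nu> = {f \<in> L1_loc. morrey_norm \<nu> f < \<infinity>}"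

end

theory Submission
  imports Defs
begin

text \<open>
  With \<open>s = sgn a * \<bar>a\<bar> powr (1 / \<theta>)\<close> and \<open>c = \<bar>a\<bar> powr (- 1 / (2 * \<theta>))\<close>, the normalized transform of \<open>f\<close> is \<open>c\<close>
  times the correlation of \<open>f\<close> with the normalized wavelet dilated by \<open>s\<close>. Substituting
  \<open>t = b + s * u\<close>, Tonelli's theorem bounds the integral of a correlation over \<open>ball x r\<close> by \<open>\<bar>s\<bar>\<close>
  times an average, weighted by the wavelet, of integrals of \<open>\<bar>f\<bar>\<close> over the translated balls \<open>ball (x + s * u) r\<close>,
  each of which the Morrey norm controls. The difference of the two transforms splits bilinearly as
  \<open>f * (\<Phi> - \<Psi>) + (f - g) * \<Psi>\<close>, and \<open>c * \<bar>s\<bar> = \<bar>a\<bar> powr (1 / (2 * \<theta>))\<close>.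

  Tonelli's theorem is applied to Borel representatives, because the product of two copies of
  \<open>lebesgue\<close> is not complete.
\<close>

section \<open>Borel representatives and Tonelli's theorem for correlations\<close>

lemma lebesgue_ex_borel_complex:
  fixes h :: "'a::euclidean_space \<Rightarrow> complex"
  assumes "h \<in> borel_measurable lebesgue"
  obtains h' where "h' \<in> borel_measurable borel" and "AE x in lborel. h x = h' x"
proof -
  have "(\<lambda>x. Re (h x)) \<in> borel_measurable lebesgue" "(\<lambda>x. Im (h x)) \<in> borel_measurable lebesgue"
    using assms by measurable
  then obtain u v where [measurable]: "u \<in> borel_measurable borel" "v \<in> borel_measurable borel"
    and ae: "AE x in lborel. Re (h x) = u x" "AE x in lborel. Im (h x) = v x"
    using completion_ex_borel_measurable_real[of "\<lambda>x. Re (h x)" lborel]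
      completion_ex_borel_measurable_real[of "\<lambda>x. Im (h x)" lborel] by auto
  show ?thesis
  proof
    show "(\<lambda>x. Complex (u x) (v x)) \<in> borel_measurable borel"
      unfolding borel_measurable_complex_iff by simp
    show "AE x in lborel. h x = Complex (u x) (v x)"
      using ae by eventually_elim (simp add: complex_eq_iff)
  qed
qed

text \<open>The set where \<open>P\<close> fails need not be Borel. It is covered by a Borel null
  set \<open>N\<close>, and \<open>x \<notin> N\<close> is a measurable predicate that can be
  transported along the affine map.\<close>

lemma AE_lborel_affine:
  fixes P :: "real \<Rightarrow> bool"
  assumes "AE x in lborel. P x" and "c \<noteq> 0"
  shows "AE x in lborel. P (t + c * x)"
proof -
  from assms(1) obtain N where N: "{x. \<not> P x} \<subseteq> N" "N \<in> null_sets lborel"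
    by (auto elim!: AE_E simp: null_sets_def)
  then have [measurable]: "N \<in> sets borel" by auto
  have "AE x in lborel. x \<notin> N" using N(2) by (rule AE_not_in)
  then have "AE x in lborel. t + c * x \<notin> N"
    by (intro AE_borel_affine) (use \<open>c \<noteq> 0\<close> in auto)
  then show ?thesis by eventually_elim (use N(1) in auto)
qed

lemma nn_integral_correlation_ball:
  fixes H X :: "real \<Rightarrow> ennreal"
  assumes [measurable]: "H \<in> borel_measurable borel" "X \<in> borel_measurable borel" and s: "s \<noteq> 0"
  shows "(\<integral>\<^sup>+ b\<in>ball x r. (\<integral>\<^sup>+ t. H t * X ((t - b) / s) \<partial>lborel) \<partial>lborel) =
    ennreal \<bar>s\<bar> * (\<integral>\<^sup>+ u. X u * (\<integral>\<^sup>+ t\<in>ball (x + s * u) r. H t \<partial>lborel) \<partial>lborel)"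
proof -
  have [measurable]: "ball x r \<in> sets borel" for x r :: real by simp
  have "(\<integral>\<^sup>+ t. H t * X ((t - b) / s) \<partial>lborel) = ennreal \<bar>s\<bar> * (\<integral>\<^sup>+ u. X u * H (b + s * u) \<partial>lborel)" for b
    using s by (subst nn_integral_real_affine[where c = s and t = b]) (simp_all add: mult.commute)
  \<comment> \<open>The indicator moves under the inner integral, so that Tonelli applies to a
    single function of \<open>b\<close> and \<open>u\<close>.\<close>
  then have "(\<integral>\<^sup>+ t. H t * X ((t - b) / s) \<partial>lborel) * indicator (ball x r) b =
      ennreal \<bar>s\<bar> * (\<integral>\<^sup>+ u. X u * H (b + s * u) * indicator (ball x r) b \<partial>lborel)" for b
    by (subst nn_integral_multc) (auto simp: mult_ac)
  then have "(\<integral>\<^sup>+ b\<in>ball x r. (\<integral>\<^sup>+ t. H t * X ((t - b) / s) \<partial>lborel) \<partial>lborel) =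
      ennreal \<bar>s\<bar> * (\<integral>\<^sup>+ b. (\<integral>\<^sup>+ u. X u * H (b + s * u) * indicator (ball x r) b \<partial>lborel) \<partial>lborel)"
    by (simp add: nn_integral_cmult)
  also have "(\<integral>\<^sup>+ b. (\<integral>\<^sup>+ u. X u * H (b + s * u) * indicator (ball x r) b \<partial>lborel) \<partial>lborel) =
      (\<integral>\<^sup>+ u. (\<integral>\<^sup>+ b. X u * H (b + s * u) * indicator (ball x r) b \<partial>lborel) \<partial>lborel)"
    by (rule lborel_pair.Fubini') measurable
  also have "\<dots> = (\<integral>\<^sup>+ u. X u * (\<integral>\<^sup>+ b. H (b + s * u) * indicator (ball x r) b \<partial>lborel) \<partial>lborel)"
    by (simp add: nn_integral_cmult mult.assoc)
  \<comment> \<open>For fixed \<open>u\<close>, the translation \<open>t = b + s * u\<close> carries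
    \<open>ball x r\<close> onto \<open>ball (x + s * u) r\<close>.\<close>
  also have "(\<lambda>u. \<integral>\<^sup>+ b. H (b + s * u) * indicator (ball x r) b \<partial>lborel) =
    (\<lambda>u. \<integral>\<^sup>+ t\<in>ball (x + s * u) r. H t \<partial>lborel)"
  proof
    fix u
    show "(\<integral>\<^sup>+ b. H (b + s * u) * indicator (ball x r) b \<partial>lborel) = (\<integral>\<^sup>+ t\<in>ball (x + s * u) r. H t \<partial>lborel)"
      by (subst (2) nn_integral_real_affine[where c = 1 and t = "s * u"])
         (auto intro!: nn_integral_cong simp: indicator_def dist_real_def add_ac)
  qed
  finally show ?thesis .
qed

section \<open>Local integrability and the Morrey norm\<close>

text \<open>The truncations of \<open>f\<close> to the balls \<open>cball 0 n\<close> are measurable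
  and at each point eventually equal to \<open>f\<close>, which is therefore their pointwise
  limit.\<close>

lemma L1_loc_borel_measurable:
  assumes "f \<in> L1_loc"
  shows "f \<in> borel_measurable lebesgue"
proof (rule borel_measurable_LIMSEQ_metric)
  fix n :: nat
  have "f absolutely_integrable_on cball 0 (real n)" using assms by (auto simp: L1_loc_def)
  then show "(\<lambda>x. indicat_real (cball 0 (real n)) x *\<^sub>R f x) \<in> borel_measurable lebesgue"
    unfolding set_integrable_def by (rule borel_measurable_integrable)
next
  fix x :: real
  obtain N :: nat where "\<bar>x\<bar> \<le> N" using real_arch_simple by blast
  then have "\<forall>\<^sub>F n in sequentially. indicat_real (cball 0 (real n)) x *\<^sub>R f x = f x"
    by (auto simp: eventually_sequentially indicator_def intro!: exI[of _ N])
  then show "(\<lambda>n. indicat_real (cball 0 (real n)) x *\<^sub>R f x) \<longlonglongrightarrow> f x"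
    by (rule tendsto_eventually)
qed

text \<open>The factor \<open>r powr \<nu>\<close> is positive and finite, so it can be moved across
  the inequality even when \<open>C\<close> is infinite. With \<open>C\<close> the Morrey norm
  itself, this gives the estimate on each ball.\<close>

lemma morrey_norm_le_iff:
  "morrey_norm \<nu> f \<le> C \<longleftrightarrow>
    (\<forall>x. \<forall>r>0. (\<integral>\<^sup>+ t\<in>ball x r. ennreal (cmod (f t)) \<partial>lebesgue) \<le> ennreal (r powr \<nu>) * C)"
proof -
  have "ennreal (1 / r powr \<nu>) * I \<le> C \<longleftrightarrow> I \<le> ennreal (r powr \<nu>) * C" if "r > 0" for r I
  proof -
    have *: "ennreal (r powr \<nu>) * ennreal (1 / r powr \<nu>) = 1"
      using that by (simp flip: ennreal_mult')
    show ?thesis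
    proof
      assume "ennreal (1 / r powr \<nu>) * I \<le> C"
      then have "ennreal (r powr \<nu>) * (ennreal (1 / r powr \<nu>) * I) \<le> ennreal (r powr \<nu>) * C"
        by (rule mult_left_mono) simp
      then show "I \<le> ennreal (r powr \<nu>) * C" by (simp only: mult.assoc[symmetric] * mult_1)
    next
      assume "I \<le> ennreal (r powr \<nu>) * C"
      then have "ennreal (1 / r powr \<nu>) * I \<le> ennreal (1 / r powr \<nu>) * (ennreal (r powr \<nu>) * C)"
        by (rule mult_left_mono) simp
      also have "\<dots> = ennreal (r powr \<nu>) * ennreal (1 / r powr \<nu>) * C" by (simp only: mult_ac)
      finally show "ennreal (1 / r powr \<nu>) * I \<le> C" by (simp only: * mult_1)
    qed
  qed
  then show ?thesis by (auto simp: morrey_norm_def SUP_le_iff)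
qed

lemma morrey_norm_cong_AE:
  assumes "AE t in lebesgue. f t = g t"
  shows "morrey_norm \<nu> f = morrey_norm \<nu> g"
proof -
  have "(\<integral>\<^sup>+ t\<in>A. ennreal (cmod (f t)) \<partial>lebesgue) = (\<integral>\<^sup>+ t\<in>A. ennreal (cmod (g t)) \<partial>lebesgue)" for A
    by (rule nn_integral_cong_AE) (use assms in eventually_elim, simp)
  then show ?thesis by (simp add: morrey_norm_def)
qed

lemma morrey_norm_cmult:
  assumes "f \<in> borel_measurable lebesgue"
  shows "morrey_norm \<nu> (\<lambda>t. c * f t) \<le> ennreal (cmod c) * morrey_norm \<nu> f"
  unfolding morrey_norm_le_iff
proof safe
  fix x r :: real assume "0 < r"
  have [measurable]: "f \<in> borel_measurable lebesgue" "ball x r \<in> sets lebesgue" using assms by auto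
  have "(\<integral>\<^sup>+ t\<in>ball x r. ennreal (cmod (c * f t)) \<partial>lebesgue) =
      ennreal (cmod c) * (\<integral>\<^sup>+ t\<in>ball x r. ennreal (cmod (f t)) \<partial>lebesgue)"
    by (simp add: norm_mult ennreal_mult' nn_integral_cmult mult.assoc)
  also have "\<dots> \<le> ennreal (cmod c) * (ennreal (r powr \<nu>) * morrey_norm \<nu> f)"
    using \<open>0 < r\<close> morrey_norm_le_iff[of \<nu> f "morrey_norm \<nu> f"] by (intro mult_left_mono) auto
  finally show "(\<integral>\<^sup>+ t\<in>ball x r. ennreal (cmod (c * f t)) \<partial>lebesgue) \<le>
      ennreal (r powr \<nu>) * (ennreal (cmod c) * morrey_norm \<nu> f)"
    by (simp add: mult_ac)
qed

lemma morrey_norm_add: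
  assumes [measurable]: "f \<in> borel_measurable lebesgue" "g \<in> borel_measurable lebesgue"
  shows "morrey_norm \<nu> (\<lambda>t. f t + g t) \<le> morrey_norm \<nu> f + morrey_norm \<nu> g"
  unfolding morrey_norm_le_iff
proof safe
  fix x r :: real assume "0 < r"
  have [measurable]: "ball x r \<in> sets lebesgue" by simp
  have "(\<integral>\<^sup>+ t\<in>ball x r. ennreal (cmod (f t + g t)) \<partial>lebesgue) \<le>
      (\<integral>\<^sup>+ t. ennreal (cmod (f t)) * indicator (ball x r) t + ennreal (cmod (g t)) * indicator (ball x r) t \<partial>lebesgue)"
    by (intro nn_integral_mono)
       (auto simp: indicator_def norm_triangle_ineq simp flip: ennreal_plus)
  also have "\<dots> = (\<integral>\<^sup>+ t\<in>ball x r. ennreal (cmod (f t)) \<partial>lebesgue) + (\<integral>\<^sup>+ t\<in>ball x r. ennreal (cmod (g t)) \<partial>lebesgue)"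
    by (rule nn_integral_add) measurable
  also have "\<dots> \<le> ennreal (r powr \<nu>) * morrey_norm \<nu> f + ennreal (r powr \<nu>) * morrey_norm \<nu> g"
    using \<open>0 < r\<close> morrey_norm_le_iff[of \<nu> f "morrey_norm \<nu> f"] morrey_norm_le_iff[of \<nu> g "morrey_norm \<nu> g"]
    by (intro add_mono) auto
  finally show "(\<integral>\<^sup>+ t\<in>ball x r. ennreal (cmod (f t + g t)) \<partial>lebesgue) \<le>
      ennreal (r powr \<nu>) * (morrey_norm \<nu> f + morrey_norm \<nu> g)"
    by (simp add: distrib_left)
qed

text \<open>A compact set lies in a ball around 0, on which the finite Morrey norm bounds the
  integral of the modulus.\<close>

lemma morrey_spaceI:
  assumes [measurable]: "f \<in> borel_measurable lebesgue" and fin: "morrey_norm \<nu> f < \<infinity>"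
  shows "f \<in> morrey_space \<nu>"
proof -
  have "f absolutely_integrable_on K" if K: "compact K" for K
  proof -
    have [measurable]: "K \<in> sets lebesgue" using K by (simp add: compact_imp_closed)
    obtain r where r: "0 < r" "K \<subseteq> ball 0 r"
      using bounded_subset_ballD[OF compact_imp_bounded[OF K], of 0] by blast
    have "(\<integral>\<^sup>+ t. norm (indicat_real K t *\<^sub>R f t) \<partial>lebesgue) \<le> (\<integral>\<^sup>+ t\<in>ball 0 r. ennreal (cmod (f t)) \<partial>lebesgue)"
      using r(2) by (intro nn_integral_mono) (auto simp: indicator_def)
    also have "\<dots> \<le> ennreal (r powr \<nu>) * morrey_norm \<nu> f"
      using \<open>0 < r\<close> morrey_norm_le_iff[of \<nu> f "morrey_norm \<nu> f"] by auto
    also have "\<dots> < \<infinity>" using fin by (simp add: ennreal_mult_less_top)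
    finally show ?thesis
      unfolding set_integrable_def by (intro integrableI_bounded) simp_all
  qed
  then show ?thesis using fin by (simp add: morrey_space_def L1_loc_def)
qed

section \<open>Correlation of a Morrey function with an integrable function\<close>

text \<open>This is the wavelet transform without its amplitude factor, \<open>s\<close> being the
  signed dilation. Its value is 0 wherever the integrand is not integrable.\<close>

definition correlation :: "real \<Rightarrow> (real \<Rightarrow> complex) \<Rightarrow> (real \<Rightarrow> complex) \<Rightarrow> real \<Rightarrow> complex" where
  "correlation s h w b = (LINT t|lebesgue. h t * cnj (w ((t - b) / s)))"

text \<open>The map from \<open>t\<close> to \<open>(t - b) / s\<close> is affine with non-zero
  slope, so null sets pull back to null sets. Hence representatives may be exchanged at every
  \<open>b\<close>, not just at almost every one.\<close>

lemma correlation_integrand_borel_version: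
  fixes s :: real and h w :: "real \<Rightarrow> complex"
  assumes "s \<noteq> 0" "AE t in lborel. h t = h' t" "AE t in lborel. w t = w' t"
  shows "AE t in lebesgue. h' t * cnj (w' ((t - b) / s)) = h t * cnj (w ((t - b) / s))"
proof -
  have "AE t in lborel. w (- b / s + 1 / s * t) = w' (- b / s + 1 / s * t)"
    using assms by (intro AE_lborel_affine) auto
  with assms(2) have "AE t in lborel. h' t * cnj (w' ((t - b) / s)) = h t * cnj (w ((t - b) / s))"
    by eventually_elim (simp add: diff_divide_distrib)
  then show ?thesis by (rule AE_completion)
qed

text \<open>The absolute integral \<open>?I\<close> dominates the correlation. Its Tonelli bound on
  balls gives the norm estimate and makes \<open>?I\<close> finite almost everywhere, hence the
  integrability. Measurability comes from the Borel representatives.\<close>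

lemma correlation_morrey:
  assumes s: "s \<noteq> 0" and h: "h \<in> borel_measurable lebesgue" and fin: "morrey_norm \<nu> h < \<infinity>"
    and w: "integrable lebesgue w"
  shows correlation_integrable: "AE b in lebesgue. integrable lebesgue (\<lambda>t. h t * cnj (w ((t - b) / s)))"
    and correlation_measurable: "correlation s h w \<in> borel_measurable lebesgue"
    and morrey_norm_correlation:
      "morrey_norm \<nu> (correlation s h w) \<le> ennreal \<bar>s\<bar> * (morrey_norm \<nu> h * L1_norm w)"
proof -
  obtain h' where [measurable]: "h' \<in> borel_measurable borel" and h': "AE t in lborel. h t = h' t"
    using lebesgue_ex_borel_complex[OF h] .
  obtain w' where [measurable]: "w' \<in> borel_measurable borel" and w': "AE t in lborel. w t = w' t"
    using lebesgue_ex_borel_complex[OF borel_measurable_integrable[OF w]] .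
  let ?k = "\<lambda>b t. h t * cnj (w ((t - b) / s))"
  let ?k' = "\<lambda>b t. h' t * cnj (w' ((t - b) / s))"
  let ?I = "\<lambda>b. \<integral>\<^sup>+ t. ennreal (cmod (h' t)) * ennreal (cmod (w' ((t - b) / s))) \<partial>lborel"
  have cnj_meas [measurable]: "cnj \<in> borel_measurable borel"
    by (intro borel_measurable_continuous_onI continuous_intros)
  have ae: "AE t in lebesgue. ?k' b t = ?k b t" for b
    using correlation_integrand_borel_version[OF s h' w'] .
  have meas': "?k' b \<in> borel_measurable lebesgue" for b
    by (rule measurable_completion) measurable
  have meas: "?k b \<in> borel_measurable lebesgue" for b
    by (rule borel_measurable_AE[OF meas' ae])
  \<comment> \<open>This holds at every \<open>b\<close>: where the integrands are not integrable,
    both sides are 0.\<close>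
  have corr: "correlation s h w b = (LINT t|lborel. ?k' b t)" for b
  proof -
    have "correlation s h w b = (LINT t|lebesgue. ?k' b t)"
      unfolding correlation_def using ae[of b] by (intro integral_cong_AE meas meas') auto
    then show ?thesis by (simp add: integral_completion)
  qed
  have nn: "(\<integral>\<^sup>+ t. ennreal (cmod (?k b t)) \<partial>lebesgue) = ?I b" for b
  proof -
    have "(\<integral>\<^sup>+ t. ennreal (cmod (?k b t)) \<partial>lebesgue) = (\<integral>\<^sup>+ t. ennreal (cmod (?k' b t)) \<partial>lebesgue)"
      by (rule nn_integral_cong_AE) (use ae[of b] in eventually_elim, simp)
    then show ?thesis by (simp add: nn_integral_completion norm_mult ennreal_mult')
  qed
  have meas_I [measurable]: "?I \<in> borel_measurable borel"
    by measurable
  have "(\<lambda>b. LINT t|lborel. ?k' b t) \<in> borel_measurable lborel"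
    by (rule lborel.borel_measurable_lebesgue_integral) measurable
  then show "correlation s h w \<in> borel_measurable lebesgue"
    unfolding corr[abs_def] by (rule measurable_completion)

  have bound: "(\<integral>\<^sup>+ b\<in>ball x r. ?I b \<partial>lborel) \<le> ennreal (r powr \<nu>) * (ennreal \<bar>s\<bar> * (morrey_norm \<nu> h * L1_norm w))"
    if r: "0 < r" for x r
  proof -
    \<comment> \<open>All translated balls have radius \<open>r\<close>, so the estimate is uniform
      in the centre and factors out of the average over \<open>u\<close>.\<close>
    have "(\<integral>\<^sup>+ t\<in>ball y r. ennreal (cmod (h' t)) \<partial>lborel) \<le> ennreal (r powr \<nu>) * morrey_norm \<nu> h" for y
    proof -
      have "(\<integral>\<^sup>+ t\<in>ball y r. ennreal (cmod (h' t)) \<partial>lborel) = (\<integral>\<^sup>+ t\<in>ball y r. ennreal (cmod (h t)) \<partial>lborel)"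
        by (rule nn_integral_cong_AE) (use h' in eventually_elim, simp)
      then show ?thesis
        using r morrey_norm_le_iff[of \<nu> h "morrey_norm \<nu> h"] by (simp add: nn_integral_completion)
    qed
    then have "(\<integral>\<^sup>+ b\<in>ball x r. ?I b \<partial>lborel) \<le>
        ennreal \<bar>s\<bar> * (\<integral>\<^sup>+ u. ennreal (cmod (w' u)) * (ennreal (r powr \<nu>) * morrey_norm \<nu> h) \<partial>lborel)"
      by (subst nn_integral_correlation_ball[OF _ _ s]) (auto intro!: mult_left_mono nn_integral_mono)
    also have "(\<integral>\<^sup>+ u. ennreal (cmod (w' u)) * (ennreal (r powr \<nu>) * morrey_norm \<nu> h) \<partial>lborel) =
        (\<integral>\<^sup>+ u. ennreal (cmod (w' u)) \<partial>lborel) * (ennreal (r powr \<nu>) * morrey_norm \<nu> h)"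
      by (rule nn_integral_multc) measurable
    also have "(\<integral>\<^sup>+ u. ennreal (cmod (w' u)) \<partial>lborel) = L1_norm w"
      unfolding L1_norm_def nn_integral_completion
      by (rule nn_integral_cong_AE) (use w' in eventually_elim, simp)
    finally show ?thesis by (simp add: mult_ac)
  qed
  show "morrey_norm \<nu> (correlation s h w) \<le> ennreal \<bar>s\<bar> * (morrey_norm \<nu> h * L1_norm w)"
    unfolding morrey_norm_le_iff
  proof safe
    fix x r :: real assume r: "0 < r"
    \<comment> \<open>Without integrability the left side is 0, so the inequality needs no
      exceptional set.\<close>
    have "ennreal (cmod (correlation s h w b)) \<le> ?I b" for b
      unfolding correlation_def nn[symmetric]
      by (cases "integrable lebesgue (?k b)") (auto simp: integral_norm_bound_ennreal not_integrable_integral_eq)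
    then have "(\<integral>\<^sup>+ b\<in>ball x r. ennreal (cmod (correlation s h w b)) \<partial>lebesgue) \<le> (\<integral>\<^sup>+ b\<in>ball x r. ?I b \<partial>lborel)"
      unfolding nn_integral_completion by (intro nn_integral_mono) (auto simp: indicator_def)
    also note bound[OF r]
    finally show "(\<integral>\<^sup>+ b\<in>ball x r. ennreal (cmod (correlation s h w b)) \<partial>lebesgue) \<le>
        ennreal (r powr \<nu>) * (ennreal \<bar>s\<bar> * (morrey_norm \<nu> h * L1_norm w))" .
  qed
  have L1: "L1_norm w < \<infinity>"
    using w by (simp add: L1_norm_def integrable_iff_bounded)
  \<comment> \<open>Countably many balls around 0 exhaust the line. The successor keeps the radius
    positive, as \<open>bound\<close> demands.\<close>
  have "AE b in lborel. ?I b * indicator (ball 0 (real (Suc n))) b \<noteq> \<infinity>" for n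
  proof (rule nn_integral_noteq_infinite)
    have [measurable]: "ball (0::real) (real (Suc n)) \<in> sets borel" by simp
    show "(\<lambda>b. ?I b * indicator (ball 0 (real (Suc n))) b) \<in> borel_measurable lborel" by measurable
    show "(\<integral>\<^sup>+ b\<in>ball 0 (real (Suc n)). ?I b \<partial>lborel) \<noteq> \<infinity>"
      using order.strict_trans1[OF bound[of "real (Suc n)" 0], of \<infinity>] fin L1
      by (auto simp: ennreal_mult_less_top)
  qed
  then have "AE b in lborel. \<forall>n. ?I b * indicator (ball 0 (real (Suc n))) b \<noteq> \<infinity>"
    by (simp add: AE_all_countable)
  then have "AE b in lborel. integrable lebesgue (?k b)"
  proof eventually_elim
    case (elim b)
    obtain n :: nat where "\<bar>b\<bar> < real n" using reals_Archimedean2 by blast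
    then have "b \<in> ball 0 (real (Suc n))" by simp
    with elim[rule_format, of n] have "?I b < \<infinity>" by (simp add: less_top)
    then show ?case
      by (intro integrableI_bounded meas) (simp add: nn)
  qed
  then show "AE b in lebesgue. integrable lebesgue (?k b)" by (rule AE_completion)
qed

section \<open>From correlations to the normalized transforms\<close>

theorem theorem4p4:
  fixes \<theta> \<nu> a :: real and f g \<phi> \<psi> :: "real \<Rightarrow> complex"
  assumes "0 < \<theta>" and "\<theta> \<le> 1"
    and "0 \<le> \<nu>" and "\<nu> \<le> 1"
    and "f \<in> morrey_space \<nu>" and "g \<in> morrey_space \<nu>"
    and "fractional_wavelet \<theta> \<phi>" and "compactly_supported \<phi>"
    and "fractional_wavelet \<theta> \<psi>" and "compactly_supported \<psi>"
    and "a \<noteq> 0"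
  shows "(AE b in lebesgue. cfrwt_defined \<theta> \<phi> f b a \<and> cfrwt_defined \<theta> \<psi> g b a) \<and>
    (\<lambda>b. normalized_cfrwt \<theta> \<phi> f b a - normalized_cfrwt \<theta> \<psi> g b a) \<in> morrey_space \<nu> \<and>
    morrey_norm \<nu> (\<lambda>b. normalized_cfrwt \<theta> \<phi> f b a - normalized_cfrwt \<theta> \<psi> g b a)
      \<le> ennreal (\<bar>a\<bar> powr (1 / (2 * \<theta>))) *
         (morrey_norm \<nu> f *
            L1_norm (\<lambda>t. \<phi> t / complex_of_real (sqrt (adm_const \<theta> \<phi>))
                       - \<psi> t / complex_of_real (sqrt (adm_const \<theta> \<psi>))) +
          morrey_norm \<nu> (\<lambda>t. f t - g t) *
            L1_norm (\<lambda>t. \<psi> t / complex_of_real (sqrt (adm_const \<theta> \<psi>))))"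
proof -
  define s where "s = sgn a * \<bar>a\<bar> powr (1 / \<theta>)"
  define c where "c = 1 / \<bar>a\<bar> powr (1 / (2 * \<theta>))"
  define \<Phi> where "\<Phi> = (\<lambda>t. \<phi> t / complex_of_real (sqrt (adm_const \<theta> \<phi>)))"
  define \<Psi> where "\<Psi> = (\<lambda>t. \<psi> t / complex_of_real (sqrt (adm_const \<theta> \<psi>)))"
  define d where "d = (\<lambda>t. f t - g t)"
  define E where "E = (\<lambda>t. \<Phi> t - \<Psi> t)"
  define D where "D = (\<lambda>b. normalized_cfrwt \<theta> \<phi> f b a - normalized_cfrwt \<theta> \<psi> g b a)"
  have s: "s \<noteq> 0" using \<open>a \<noteq> 0\<close> by (simp add: s_def sgn_zero_iff)
  have c: "0 < c" using \<open>a \<noteq> 0\<close> by (simp add: c_def)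
  have cs: "c * \<bar>s\<bar> = \<bar>a\<bar> powr (1 / (2 * \<theta>))"
  proof -
    \<comment> \<open>The modulus of \<open>s\<close> is
      \<open>\<bar>a\<bar> powr (1 / \<theta>)\<close>, the square of the reciprocal of
      \<open>c\<close>.\<close>
    have "\<bar>s\<bar> = \<bar>a\<bar> powr (1 / (2 * \<theta>)) * \<bar>a\<bar> powr (1 / (2 * \<theta>))"
      using \<open>a \<noteq> 0\<close> by (simp add: s_def abs_mult abs_sgn_eq flip: powr_add)
    then show ?thesis using \<open>a \<noteq> 0\<close> by (simp add: c_def)
  qed
  have f: "f \<in> borel_measurable lebesgue" "morrey_norm \<nu> f < \<infinity>"
    and g: "g \<in> borel_measurable lebesgue" "morrey_norm \<nu> g < \<infinity>"
    using assms by (auto simp: morrey_space_def intro: L1_loc_borel_measurable)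
  have d: "d \<in> borel_measurable lebesgue" "morrey_norm \<nu> d < \<infinity>"
  proof -
    show "d \<in> borel_measurable lebesgue" unfolding d_def using f g by measurable
    \<comment> \<open>The difference is read as \<open>f\<close> plus \<open>-1\<close> times
      \<open>g\<close>, so that subadditivity and scaling apply.\<close>
    have "morrey_norm \<nu> d \<le> morrey_norm \<nu> f + morrey_norm \<nu> (\<lambda>t. - 1 * g t)"
      using morrey_norm_add[of f "\<lambda>t. - 1 * g t" \<nu>] f g by (simp add: d_def)
    also have "\<dots> \<le> morrey_norm \<nu> f + morrey_norm \<nu> g"
      using morrey_norm_cmult[OF g(1), of \<nu> "- 1"] by (intro add_mono) auto
    also have "\<dots> < \<infinity>" using f g by simp
    finally show "morrey_norm \<nu> d < \<infinity>" .
  qed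
  have \<phi>: "integrable lebesgue \<phi>" and \<psi>: "integrable lebesgue \<psi>"
    using assms by (auto simp: fractional_wavelet_def)
  then have \<Phi>: "integrable lebesgue \<Phi>" and \<Psi>: "integrable lebesgue \<Psi>" by (auto simp: \<Phi>_def \<Psi>_def)
  then have E: "integrable lebesgue E" by (auto simp: E_def)

  have def_ae: "AE b in lebesgue. cfrwt_defined \<theta> w h b a"
    if "h \<in> borel_measurable lebesgue" "morrey_norm \<nu> h < \<infinity>" "integrable lebesgue w" for w h
    using correlation_integrable[OF s that]
  proof eventually_elim
    case (elim b)
    then have "integrable lebesgue (\<lambda>t. c * (h t * cnj (w ((t - b) / s))))" by simp
    then show ?case by (simp add: cfrwt_defined_def daughter_def s_def c_def mult_ac)
  qed
  \<comment> \<open>Constants leave a Bochner integral even when the integrand is not integrable, so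
    this holds at every \<open>b\<close>. The normalizing constant \<open>k\<close> is real and may
    pass under the conjugation.\<close>
  have norm_eq: "normalized_cfrwt \<theta> w h b a =
      c * correlation s h (\<lambda>t. w t / complex_of_real (sqrt (adm_const \<theta> w))) b" for w h b
  proof -
    define k where "k = complex_of_real (1 / sqrt (adm_const \<theta> w))"
    have "normalized_cfrwt \<theta> w h b a = (LINT t|lebesgue. k * (h t * cnj (c * w ((t - b) / s))))"
      unfolding normalized_cfrwt_def cfrwt_def daughter_def integral_mult_right_zero k_def c_def s_def ..
    also have "\<dots> = (LINT t|lebesgue. c * (h t * cnj (k * w ((t - b) / s))))"
    proof -
      have "cnj k = k" by (simp add: k_def)
      then show ?thesis by (simp only: complex_cnj_mult complex_cnj_complex_of_real mult_ac)
    qed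
    also have "\<dots> = c * (LINT t|lebesgue. h t * cnj (k * w ((t - b) / s)))"
      by (rule integral_mult_right_zero)
    finally show ?thesis by (simp add: correlation_def k_def)
  qed
  \<comment> \<open>The mixed correlation of \<open>f\<close> with \<open>\<Psi>\<close> is
    subtracted and added. Linearity of the integral requires all three correlations to be
    integrable, whence the restriction to almost every \<open>b\<close>.\<close>
  have D_ae: "AE b in lebesgue. c * (correlation s f E b + correlation s d \<Psi> b) = D b"
    using correlation_integrable[OF s f \<Phi>] correlation_integrable[OF s f \<Psi>] correlation_integrable[OF s g \<Psi>]
  proof eventually_elim
    case (elim b)
    have "correlation s f E b = correlation s f \<Phi> b - correlation s f \<Psi> b"
      using elim by (simp add: correlation_def E_def right_diff_distrib)
    moreover have "correlation s d \<Psi> b = correlation s f \<Psi> b - correlation s g \<Psi> b"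
      using elim by (simp add: correlation_def d_def left_diff_distrib)
    ultimately show ?case by (simp add: D_def norm_eq \<Phi>_def \<Psi>_def right_diff_distrib)
  qed
  note [measurable] = correlation_measurable[OF s f E] correlation_measurable[OF s d \<Psi>]
  \<comment> \<open>Completeness of \<open>lebesgue\<close> passes measurability to a function known
    only up to a null set.\<close>
  have D_meas: "D \<in> borel_measurable lebesgue"
    by (rule borel_measurable_AE[OF _ D_ae]) measurable
  have "morrey_norm \<nu> D = morrey_norm \<nu> (\<lambda>b. c * (correlation s f E b + correlation s d \<Psi> b))"
    using D_ae by (rule morrey_norm_cong_AE[symmetric])
  also have "\<dots> \<le> ennreal (cmod c) * morrey_norm \<nu> (\<lambda>b. correlation s f E b + correlation s d \<Psi> b)"
    by (rule morrey_norm_cmult) measurable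
  also have "\<dots> \<le> ennreal (cmod c) * (morrey_norm \<nu> (correlation s f E) + morrey_norm \<nu> (correlation s d \<Psi>))"
    by (intro mult_left_mono morrey_norm_add) auto
  also have "\<dots> \<le> ennreal (cmod c) * (ennreal \<bar>s\<bar> * (morrey_norm \<nu> f * L1_norm E) +
      ennreal \<bar>s\<bar> * (morrey_norm \<nu> d * L1_norm \<Psi>))"
    using morrey_norm_correlation[OF s f E] morrey_norm_correlation[OF s d \<Psi>]
    by (intro mult_left_mono add_mono) auto
  also have "\<dots> = ennreal (c * \<bar>s\<bar>) * (morrey_norm \<nu> f * L1_norm E + morrey_norm \<nu> d * L1_norm \<Psi>)"
    using c by (simp add: ennreal_mult distrib_left mult.assoc)
  finally have bound: "morrey_norm \<nu> D \<le>
      ennreal (\<bar>a\<bar> powr (1 / (2 * \<theta>))) * (morrey_norm \<nu> f * L1_norm E + morrey_norm \<nu> d * L1_norm \<Psi>)"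
    by (simp add: cs)
  have "L1_norm E < \<infinity>" "L1_norm \<Psi> < \<infinity>"
    using E \<Psi> by (simp_all add: L1_norm_def integrable_iff_bounded)
  \<comment> \<open>The right side of \<open>bound\<close> is finite, which also yields membership
    in the Morrey space.\<close>
  then have "morrey_norm \<nu> D < \<infinity>"
    using f d by (intro order.strict_trans1[OF bound]) (simp add: ennreal_mult_less_top)
  then have "D \<in> morrey_space \<nu>" by (rule morrey_spaceI[OF D_meas])
  moreover have "AE b in lebesgue. cfrwt_defined \<theta> \<phi> f b a \<and> cfrwt_defined \<theta> \<psi> g b a"
    using def_ae[OF f \<phi>] def_ae[OF g \<psi>] by eventually_elim simp
  ultimately show ?thesis
    using bound unfolding D_def d_def E_def \<Phi>_def \<Psi>_def by blast
qed

end
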